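(* Let $q\in\mathbb{C}$, $s\in\mathbb{N}_0$, $\alpha_0,\dots,\alpha_s\in\mathbb{C}$, $f(Y)=\sum_{j=0}^s\alpha_jY^j$, and let $X,Y$ be the generators of the $q$-deformed polynomial Weyl algebra $\mathcal{A}_f(q)$. Let $\mathrm{w}=Y^{n_r}X^{m_r}\cdots Y^{n_1}X^{m_1}$ with $n_j,m_j\in\mathbb{N}_0$, $|\mathbf{n}|=\sum n_j$, $|\mathbf{m}|=\sum m_j$. Then in $\mathcal{A}_f(q)$ $$\mathrm{w}=\sum_{k=0}^{|\mathbf{m}|-m_1}\ \sum_{\mathbf{k}\in\mathcal{WC}_{s+1}(k)} m_{\mathbf{k}}(B_{\mathrm{w}};q)\,Y^{|\mathbf{n}|+\sum_{j=0}^s(j-1)k_j}X^{|\mathbf{m}|-k}.$$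
   Context: $\mathcal{A}_f(q)$ is the complex unital algebra generated by $X,Y$ with $XY-qYX=f(Y)=\sum_{j=0}^s\alpha_jY^j$. $\mathcal{WC}_{s+1}(k)$ is the set of $\mathbf{k}=(k_0,\dots,k_s)\in\mathbb{N}_0^{s+1}$ with $k_0+\cdots+k_s=k$; $\boldsymbol{\alpha}^{\mathbf{k}}=\prod_j\alpha_j^{k_j}$. Board of a word: $B_{\mathrm{w}}$ is the Ferrers board whose columns correspond to the letters $X$ of $\mathrm{w}$ read from left to right, the column of a given $X$ having height equal to the number of letters $Y$ to the right of that $X$ in $\mathrm{w}$ (columns are top-aligned; heights weakly decrease from left to right). It is the board outlined by the lattice path from $(0,0)$ with $X$ a right step and $Y$ an up step. Mixed rook placements (Goldman–Haglund row creation rule): let $B$ have columns $c_1,\dots,c_N$ from left to right with heights $h_1\ge\cdots\ge h_N\ge0$. A mixed rook placement of type $\mathbf{k}=(k_0,\dots,k_s)$ is built by processing columns from right to left; in each column one places either no rook or one rook of some weight $w\in\{0,\dots,s\}$ in one of the available cells of that column; a rook of weight $w$ occupies its row (which becomes unavailable in all columns to its left) and creates $w$ new rows extending all columns to its left. Concretely, column $c$ has $a_c=h_c+\sum(w-1)$ available cells, the sum over rooks already placed in columns to the right of $c$, $w$ their weights ($a_c\ge0$ always); the available cells are ordered from bottom (position 1) to top (position $a_c$), and a rook in column $c$ is placed at some position $p_c\in\{1,\dots,a_c\}$. The placement has exactly $k_w$ rooks of weight $w$ for each $w$. $\mathcal{M}_{\mathbf{k}}(B)$ is the set of such placements. Empty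 boxes: in a column without a rook, all its $a_c$ available cells; in a column with a rook at position $p_c$, the $p_c-1$ available cells below the rook (all other cells are rook boxes or cancelled). The $q$-deformed mixed placement number is $m_{\mathbf{k}}(B;q)=\boldsymbol{\alpha}^{\mathbf{k}}\sum_{\phi\in\mathcal{M}_{\mathbf{k}}(B)}q^{\#\text{empty boxes of }\phi}$. (Rooks of weight 0 are ordinary non-attacking rooks, rooks of weight 1 behave as files.) *)

theory Defs
  imports Complex_Main "HOL-Library.Poly_Mapping" "HOL-Algebra.QuotRing"
begin

section \<open>The $q$-deformed polynomial Weyl algebra\<close>

datatype letter = LX | LY

text \<open>Words are wrapped so that they carry the additive monoid structure (concatenation) over which
  \<^type>\<open>poly_mapping\<close> is the monoid algebra; its convolution product then makes
  finitely supported functions on words the free unital algebra on \<open>X\<close> and \<open>Y\<close>.\<close>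

datatype fword = FWord "letter list"

instantiation fword :: monoid_add
begin

definition zero_fword :: fword where
  "zero_fword = FWord []"

fun plus_fword :: "fword \<Rightarrow> fword \<Rightarrow> fword" where
  "plus_fword (FWord u) (FWord v) = FWord (u @ v)"

instance
proof
  fix a b c :: fword
  show "a + b + c = a + (b + c)" by (cases a; cases b; cases c) simp
  show "0 + a = a" by (cases a) (simp add: zero_fword_def)
  show "a + 0 = a" by (cases a) (simp add: zero_fword_def)
qed

end

type_synonym free_poly = "(fword, complex) poly_mapping"

definition free_const :: "complex \<Rightarrow> free_poly" where
  "free_const c = Poly_Mapping.single 0 c"

definition free_gen :: "letter \<Rightarrow> free_poly" where
  "free_gen l = Poly_Mapping.single (FWord [l]) 1"

definition free_alg :: "free_poly ring" where
  "free_alg = \<lparr>carrier = UNIV, mult = (*), one = 1, zero = 0, add = (+)\<rparr>"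

definition weyl_relator :: "nat \<Rightarrow> (nat \<Rightarrow> complex) \<Rightarrow> complex \<Rightarrow> free_poly" where
  "weyl_relator s \<alpha> q =
     free_gen LX * free_gen LY - free_const q * (free_gen LY * free_gen LX)
     - (\<Sum>j\<le>s. free_const (\<alpha> j) * free_gen LY ^ j)"

text \<open>A two-sided ring ideal of the free algebra is automatically stable under the scalars, since
  these are elements of the free algebra.\<close>

definition weyl_ideal :: "nat \<Rightarrow> (nat \<Rightarrow> complex) \<Rightarrow> complex \<Rightarrow> free_poly set" where
  "weyl_ideal s \<alpha> q = Idl\<^bsub>free_alg\<^esub> {weyl_relator s \<alpha> q}"

definition weyl_alg :: "nat \<Rightarrow> (nat \<Rightarrow> complex) \<Rightarrow> complex \<Rightarrow> free_poly set ring" where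
  "weyl_alg s \<alpha> q = free_alg Quot weyl_ideal s \<alpha> q"

definition weyl_class :: "nat \<Rightarrow> (nat \<Rightarrow> complex) \<Rightarrow> complex \<Rightarrow> free_poly \<Rightarrow> free_poly set" where
  "weyl_class s \<alpha> q x = weyl_ideal s \<alpha> q +>\<^bsub>free_alg\<^esub> x"

definition weyl_gen :: "nat \<Rightarrow> (nat \<Rightarrow> complex) \<Rightarrow> complex \<Rightarrow> letter \<Rightarrow> free_poly set" where
  "weyl_gen s \<alpha> q l = weyl_class s \<alpha> q (free_gen l)"

definition weyl_scale ::
    "nat \<Rightarrow> (nat \<Rightarrow> complex) \<Rightarrow> complex \<Rightarrow> complex \<Rightarrow> free_poly set \<Rightarrow> free_poly set" where
  "weyl_scale s \<alpha> q c a = weyl_class s \<alpha> q (free_const c) \<otimes>\<^bsub>weyl_alg s \<alpha> q\<^esub> a"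

definition weyl_word ::
    "nat \<Rightarrow> (nat \<Rightarrow> complex) \<Rightarrow> complex \<Rightarrow> letter list \<Rightarrow> free_poly set" where
  "weyl_word s \<alpha> q w =
     foldr (\<lambda>l a. weyl_gen s \<alpha> q l \<otimes>\<^bsub>weyl_alg s \<alpha> q\<^esub> a) w \<one>\<^bsub>weyl_alg s \<alpha> q\<^esub>"

section \<open>Words and boards\<close>

text \<open>The word $Y^{n_r}X^{m_r}\cdots Y^{n_1}X^{m_1}$.\<close>

definition block_word :: "nat \<Rightarrow> (nat \<Rightarrow> nat) \<Rightarrow> (nat \<Rightarrow> nat) \<Rightarrow> letter list" where
  "block_word r n m =
     concat (map (\<lambda>j. replicate (n j) LY @ replicate (m j) LX) (rev [1..<Suc r]))"

text \<open>A board is given by its column heights, listed from left to right.\<close>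

fun board :: "letter list \<Rightarrow> nat list" where
  "board [] = []"
| "board (LX # w) = count_list w LY # board w"
| "board (LY # w) = board w"

section \<open>Mixed rook placements\<close>

text \<open>A placement assigns to each column either no rook or the pair (weight, position) of its rook,
  positions being counted from the bottom of the available cells, starting with 1.\<close>

type_synonym placement = "(nat \<times> nat) option list"

text \<open>Integer-valued because the summand for a rook of weight 0 is \<open>-1\<close>; for a valid placement on a
  board with weakly decreasing heights the value is never negative, so that the conversion
  \<^const>\<open>nat\<close> in \<open>empty_boxes\<close> below does not truncate.\<close>

definition avail :: "nat list \<Rightarrow> placement \<Rightarrow> nat \<Rightarrow> int" where
  "avail B \<phi> c = int (B ! c) +
     (\<Sum>d\<in>{c<..<length B}. case \<phi> ! d of None \<Rightarrow> 0 | Some (w, p) \<Rightarrow> int w - 1)"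

definition mixed_placements :: "nat \<Rightarrow> nat list \<Rightarrow> nat list \<Rightarrow> placement set" where
  "mixed_placements s ks B = {\<phi>. length \<phi> = length B \<and>
     (\<forall>c<length B. \<forall>w p. \<phi> ! c = Some (w, p) \<longrightarrow> w \<le> s \<and> 1 \<le> p \<and> int p \<le> avail B \<phi> c) \<and>
     (\<forall>w\<le>s. card {c. c < length B \<and> (\<exists>p. \<phi> ! c = Some (w, p))} = ks ! w)}"

definition empty_boxes :: "nat list \<Rightarrow> placement \<Rightarrow> nat" where
  "empty_boxes B \<phi> =
     (\<Sum>c<length B. case \<phi> ! c of None \<Rightarrow> nat (avail B \<phi> c) | Some (w, p) \<Rightarrow> p - 1)"

definition mixed_number ::
    "nat \<Rightarrow> (nat \<Rightarrow> complex) \<Rightarrow> complex \<Rightarrow> nat list \<Rightarrow> nat list \<Rightarrow> complex" where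
  "mixed_number s \<alpha> q ks B =
     (\<Prod>j\<le>s. \<alpha> j ^ (ks ! j)) * (\<Sum>\<phi>\<in>mixed_placements s ks B. q ^ empty_boxes B \<phi>)"

definition weak_compositions :: "nat \<Rightarrow> nat \<Rightarrow> nat list set" where
  "weak_compositions l k = {ks. length ks = l \<and> sum_list ks = k}"

text \<open>The exponent $N + \sum_{j=0}^s (j-1)k_j$. It is negative only when there is no placement of
  type \<open>ks\<close> on a board whose leftmost column has height at most \<open>N\<close>; the corresponding coefficient
  is then 0 and the truncation by \<^const>\<open>nat\<close> is immaterial.\<close>

definition y_exponent :: "nat \<Rightarrow> nat \<Rightarrow> nat list \<Rightarrow> nat" where
  "y_exponent s N ks = nat (int N + (\<Sum>j\<le>s. (int j - 1) * int (ks ! j)))"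

end

(* Induction on the word from the left, over all placements at once. Modulo the relator,
     X Y^e = q^e Y^e X + sum_(i<e) sum_(j<=s) q^i alpha_j Y^(e-1+j),
   so moving a new letter X past Y^e either keeps it or trades it for Y^(j-1). If Y^e X^b is the
   monomial of a placement phi of the remaining word, then e is exactly the number of available
   cells of the new leftmost column; the first term is the empty column with its e empty boxes,
   the term (i, j) is a rook of weight j at position i + 1 with i empty boxes below it. A new
   letter Y only raises the exponents. Sorting the placements by type gives the formula; the
   trailing X^(m_1) contributes columns without cells, which bounds the number of rooks. *)

theory Submission
  imports Defs
begin

section \<open>The quotient map\<close>

lemma free_alg_simps [simp]:
  "carrier free_alg = UNIV" "mult free_alg = (*)" "one free_alg = 1" "zero free_alg = 0"
  "add free_alg = (+)"
  by (simp_all add: free_alg_def)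

lemma ring_free_alg: "ring free_alg"
proof (rule ringI)
  show "abelian_group free_alg"
  proof (rule abelian_groupI)
    fix x :: free_poly
    show "\<exists>y\<in>carrier free_alg. y \<oplus>\<^bsub>free_alg\<^esub> x = \<zero>\<^bsub>free_alg\<^esub>"
      by (auto intro: exI[of _ "- x"])
  qed (auto simp: algebra_simps)
  show "monoid free_alg"
    by (rule monoidI) (auto simp: algebra_simps)
qed (auto simp: algebra_simps)

context
  fixes s :: nat and \<alpha> :: "nat \<Rightarrow> complex" and q :: complex
begin

abbreviation cls :: "free_poly \<Rightarrow> free_poly set" where
  "cls \<equiv> weyl_class s \<alpha> q"

lemma ideal_weyl_ideal: "ideal (weyl_ideal s \<alpha> q) free_alg"
  unfolding weyl_ideal_def by (rule ring.genideal_ideal[OF ring_free_alg]) simp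

lemma ring_weyl_alg: "ring (weyl_alg s \<alpha> q)"
  unfolding weyl_alg_def by (rule ideal.quotient_is_ring[OF ideal_weyl_ideal])

text \<open>Computations are done with representatives in the free algebra, where the ring type
  class is available; this homomorphism carries them over to the operations of the quotient
  record.\<close>

lemma cls_ring_hom: "cls \<in> ring_hom free_alg (weyl_alg s \<alpha> q)"
  using ideal.rcos_ring_hom[OF ideal_weyl_ideal]
  unfolding weyl_alg_def weyl_class_def[abs_def] .

lemma cls_closed: "cls x \<in> carrier (weyl_alg s \<alpha> q)"
  using ring_hom_closed[OF cls_ring_hom] by simp

lemma cls_add: "cls (x + y) = cls x \<oplus>\<^bsub>weyl_alg s \<alpha> q\<^esub> cls y"
  using ring_hom_add[OF cls_ring_hom] by simp

lemma cls_mult: "cls (x * y) = cls x \<otimes>\<^bsub>weyl_alg s \<alpha> q\<^esub> cls y"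
  using ring_hom_mult[OF cls_ring_hom] by simp

lemma cls_one: "cls 1 = \<one>\<^bsub>weyl_alg s \<alpha> q\<^esub>"
  using ring_hom_one[OF cls_ring_hom] by simp

lemma cls_zero: "cls 0 = \<zero>\<^bsub>weyl_alg s \<alpha> q\<^esub>"
  using ring_hom_zero[OF cls_ring_hom ring_free_alg ring_weyl_alg] by simp

lemma cls_power: "cls (x ^ k) = cls x [^]\<^bsub>weyl_alg s \<alpha> q\<^esub> k"
proof (induction k)
  case 0
  then show ?case by (simp add: cls_one)
next
  case (Suc k)
  then show ?case by (simp only: power_Suc2 cls_mult nat_pow_Suc)
qed

lemma cls_sum: "finite S \<Longrightarrow> cls (sum g S) = (\<Oplus>\<^bsub>weyl_alg s \<alpha> q\<^esub>i\<in>S. cls (g i))"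
proof (induction S rule: finite_induct)
  case empty
  interpret ring "weyl_alg s \<alpha> q" by (rule ring_weyl_alg)
  show ?case by (simp add: cls_zero)
next
  case (insert x F)
  interpret ring "weyl_alg s \<alpha> q" by (rule ring_weyl_alg)
  show ?case using insert by (simp add: cls_add cls_closed)
qed

lemma cls_word: "weyl_word s \<alpha> q w = cls (prod_list (map free_gen w))"
  unfolding weyl_word_def by (induction w) (simp_all add: cls_one cls_mult weyl_gen_def)

text \<open>Equality of classes is congruence modulo the ideal; this rule and its two analogues for
  sums allow rewriting below products and sums of representatives.\<close>

lemma cls_mult_cong: "cls x = cls x' \<Longrightarrow> cls y = cls y' \<Longrightarrow> cls (x * y) = cls (x' * y')"
  by (simp add: cls_mult)

lemma cls_add_cong: "cls x = cls x' \<Longrightarrow> cls y = cls y' \<Longrightarrow> cls (x + y) = cls (x' + y')"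
  by (simp add: cls_add)

lemma cls_sum_cong: "(\<And>i. i \<in> S \<Longrightarrow> cls (g i) = cls (h i)) \<Longrightarrow> cls (sum g S) = cls (sum h S)"
  by (induction S rule: infinite_finite_induct) (simp_all add: cls_add)

lemma cls_XY:
  "cls (free_gen LX * free_gen LY) =
   cls (free_const q * (free_gen LY * free_gen LX) + (\<Sum>j\<le>s. free_const (\<alpha> j) * free_gen LY ^ j))"
  (is "cls ?a = cls ?b")
proof -
  interpret I: ideal "weyl_ideal s \<alpha> q" free_alg by (rule ideal_weyl_ideal)
  interpret ring "weyl_alg s \<alpha> q" by (rule ring_weyl_alg)
  let ?r = "weyl_relator s \<alpha> q"
  have "?r \<in> weyl_ideal s \<alpha> q"
    unfolding weyl_ideal_def by (rule ring.genideal_self'[OF ring_free_alg]) simp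
  \<comment> \<open>The coset of an element of the ideal is the ideal itself, which is the zero of
    the quotient.\<close>
  then have "cls ?r = weyl_ideal s \<alpha> q"
    unfolding weyl_class_def by (rule I.a_rcos_const)
  then have "cls ?r = \<zero>\<^bsub>weyl_alg s \<alpha> q\<^esub>"
    by (simp add: weyl_alg_def FactRing_def)
  moreover have "?a = ?r + ?b"
    by (simp add: weyl_relator_def)
  ultimately show ?thesis
    by (simp add: cls_add cls_closed)
qed

end

section \<open>Scalars of the free algebra\<close>

lemma free_const_mult: "free_const (a * b) = free_const a * free_const b"
  by (simp add: free_const_def mult_single)

lemma free_const_1 [simp]: "free_const 1 = 1"
  by (simp add: free_const_def)

lemma free_const_0 [simp]: "free_const 0 = 0"
  by (simp add: free_const_def)

lemma free_const_add: "free_const (a + b) = free_const a + free_const b"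
  by (simp add: free_const_def single_add)

lemma free_const_sum: "free_const (sum g S) = (\<Sum>i\<in>S. free_const (g i))"
  by (induction S rule: infinite_finite_induct) (simp_all add: free_const_add)

text \<open>Scalars are supported at the empty word, the neutral element of concatenation, and hence
  commute with the generators of this noncommutative ring.\<close>

lemma free_const_gen_commute: "free_gen l * free_const c = free_const c * free_gen l"
  by (simp add: free_const_def free_gen_def mult_single)

lemma free_const_gen_left_commute:
  "free_gen l * (free_const c * x) = free_const c * (free_gen l * x)"
  by (simp add: free_const_gen_commute flip: mult.assoc)

section \<open>Moving X past a power of Y\<close>

text \<open>Induction on \<open>e\<close>: the relation turns \<open>X Y^(e+1)\<close> into
  \<open>q Y (X Y^e) + f(Y) Y^e\<close>, and the induction hypothesis applies to the inner
  \<open>X Y^e\<close>. The truncated \<open>e - 1\<close> is harmless, since the sum over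
  \<open>i\<close> is empty for \<open>e = 0\<close>.\<close>

lemma cls_X_Y_power:
  "weyl_class s \<alpha> q (free_gen LX * free_gen LY ^ e) =
   weyl_class s \<alpha> q (free_const (q ^ e) * (free_gen LY ^ e * free_gen LX) +
     (\<Sum>i<e. \<Sum>j\<le>s. free_const (q ^ i * \<alpha> j) * free_gen LY ^ (e - 1 + j)))"
proof (induction e)
  case 0
  then show ?case by simp
next
  case (Suc e)
  let ?X = "free_gen LX" and ?Y = "free_gen LY"
  let ?f = "\<Sum>j\<le>s. free_const (\<alpha> j) * ?Y ^ j"
  let ?S = "\<lambda>e. \<Sum>i<e. \<Sum>j\<le>s. free_const (q ^ i * \<alpha> j) * ?Y ^ (e - 1 + j)"
  have "weyl_class s \<alpha> q (?X * ?Y ^ Suc e) = weyl_class s \<alpha> q ((?X * ?Y) * ?Y ^ e)"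
    by (simp add: mult.assoc)
  also have "\<dots> = weyl_class s \<alpha> q ((free_const q * (?Y * ?X) + ?f) * ?Y ^ e)"
    by (rule cls_mult_cong[OF cls_XY refl])
  also have "(free_const q * (?Y * ?X) + ?f) * ?Y ^ e = free_const q * ?Y * (?X * ?Y ^ e) + ?f * ?Y ^ e"
    by (simp add: algebra_simps)
  also have "weyl_class s \<alpha> q \<dots> = weyl_class s \<alpha> q
     (free_const q * ?Y * (free_const (q ^ e) * (?Y ^ e * ?X) + ?S e) + ?f * ?Y ^ e)"
    by (rule cls_add_cong[OF cls_mult_cong[OF refl Suc.IH] refl])
  also have "free_const q * ?Y * (free_const (q ^ e) * (?Y ^ e * ?X) + ?S e) + ?f * ?Y ^ e =
     free_const (q ^ Suc e) * (?Y ^ Suc e * ?X) + (free_const q * ?Y * ?S e + ?f * ?Y ^ e)"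
    by (simp add: distrib_left free_const_mult free_const_gen_left_commute mult.assoc)
  also have "free_const q * ?Y * ?S e =
      (\<Sum>i<e. \<Sum>j\<le>s. free_const (q ^ Suc i * \<alpha> j) * ?Y ^ (Suc e - 1 + j))"
    unfolding sum_distrib_left
  proof (intro sum.cong refl)
    fix i j assume "i \<in> {..<e}"
    \<comment> \<open>An index below \<open>e\<close> exists, so \<open>e\<close> is positive and
      \<open>e - 1\<close> does not truncate.\<close>
    then have "free_gen LY ^ (Suc e - 1 + j) = free_gen LY * free_gen LY ^ (e - 1 + j)"
      by (cases e) auto
    then show "free_const q * ?Y * (free_const (q ^ i * \<alpha> j) * ?Y ^ (e - 1 + j)) =
       free_const (q ^ Suc i * \<alpha> j) * ?Y ^ (Suc e - 1 + j)"
      by (simp add: free_const_mult free_const_gen_left_commute mult.assoc)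
  qed
  \<comment> \<open>These are the summands with \<open>i = 0\<close> of the new sum; the old sum,
    multiplied by \<open>q Y\<close>, supplies the shifted indices \<open>Suc i\<close>.\<close>
  also have "?f * ?Y ^ e = (\<Sum>j\<le>s. free_const (q ^ 0 * \<alpha> j) * ?Y ^ (Suc e - 1 + j))"
    by (simp add: sum_distrib_right mult.assoc add.commute flip: power_add)
  also have "(\<Sum>i<e. \<Sum>j\<le>s. free_const (q ^ Suc i * \<alpha> j) * ?Y ^ (Suc e - 1 + j)) +
      (\<Sum>j\<le>s. free_const (q ^ 0 * \<alpha> j) * ?Y ^ (Suc e - 1 + j)) = ?S (Suc e)"
    unfolding sum.lessThan_Suc_shift by (rule add.commute)
  finally show ?case .
qed

section \<open>Placements of arbitrary type\<close>

text \<open>Leaving the type open makes these sets recursive in the leftmost column; the type is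
  restored by the final grouping.\<close>

definition placements :: "nat \<Rightarrow> nat list \<Rightarrow> placement set" where
  "placements s B = {\<phi>. length \<phi> = length B \<and>
     (\<forall>c<length B. \<forall>w p. \<phi> ! c = Some (w, p) \<longrightarrow> w \<le> s \<and> 1 \<le> p \<and> int p \<le> avail B \<phi> c)}"

definition rook_count :: "placement \<Rightarrow> nat \<Rightarrow> nat" where
  "rook_count \<phi> w = length (filter (\<lambda>x. \<exists>p. x = Some (w, p)) \<phi>)"

definition rooks :: "nat \<Rightarrow> placement \<Rightarrow> nat" where
  "rooks s \<phi> = (\<Sum>j\<le>s. rook_count \<phi> j)"

text \<open>The net change of the exponent of Y, as a rook of weight \<open>j\<close> trades one Y
  for \<open>j\<close> of them; equally the net number of rows added for columns further
  left.\<close>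

definition gain :: "nat \<Rightarrow> placement \<Rightarrow> int" where
  "gain s \<phi> = (\<Sum>j\<le>s. (int j - 1) * int (rook_count \<phi> j))"

definition rook_weight :: "nat \<Rightarrow> (nat \<Rightarrow> complex) \<Rightarrow> placement \<Rightarrow> complex" where
  "rook_weight s \<alpha> \<phi> = (\<Prod>j\<le>s. \<alpha> j ^ rook_count \<phi> j)"

section \<open>Effect of a new leftmost column on the statistics of a placement\<close>

lemma rook_count_simps [simp]:
  "rook_count [] j = 0"
  "rook_count (None # \<phi>) j = rook_count \<phi> j"
  "rook_count (Some (w, p) # \<phi>) j = (if j = w then 1 else 0) + rook_count \<phi> j"
  by (auto simp: rook_count_def)

lemma rooks_simps [simp]:
  "rooks s [] = 0"
  "rooks s (None # \<phi>) = rooks s \<phi>"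
  "w \<le> s \<Longrightarrow> rooks s (Some (w, p) # \<phi>) = Suc (rooks s \<phi>)"
  by (simp_all add: rooks_def sum.distrib)

lemma gain_simps [simp]:
  "gain s [] = 0"
  "gain s (None # \<phi>) = gain s \<phi>"
  "w \<le> s \<Longrightarrow> gain s (Some (w, p) # \<phi>) = int w - 1 + gain s \<phi>"
proof -
  assume "w \<le> s"
  have "gain s (Some (w, p) # \<phi>) =
      (\<Sum>j\<le>s. (if j = w then int j - 1 else 0) + (int j - 1) * int (rook_count \<phi> j))"
    unfolding gain_def by (intro sum.cong refl) (simp add: algebra_simps)
  then show "gain s (Some (w, p) # \<phi>) = int w - 1 + gain s \<phi>"
    using \<open>w \<le> s\<close> by (simp add: gain_def sum.distrib)
qed (simp_all add: gain_def)

lemma rook_weight_simps [simp]: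
  "rook_weight s \<alpha> [] = 1"
  "rook_weight s \<alpha> (None # \<phi>) = rook_weight s \<alpha> \<phi>"
  "w \<le> s \<Longrightarrow> rook_weight s \<alpha> (Some (w, p) # \<phi>) = \<alpha> w * rook_weight s \<alpha> \<phi>"
proof -
  assume "w \<le> s"
  have "rook_weight s \<alpha> (Some (w, p) # \<phi>) =
      (\<Prod>j\<le>s. (if j = w then \<alpha> j else 1) * \<alpha> j ^ rook_count \<phi> j)"
    unfolding rook_weight_def by (intro prod.cong refl) simp
  then show "rook_weight s \<alpha> (Some (w, p) # \<phi>) = \<alpha> w * rook_weight s \<alpha> \<phi>"
    using \<open>w \<le> s\<close> by (simp add: rook_weight_def prod.distrib)
qed (simp_all add: rook_weight_def)

text \<open>The cells of a column depend only on the columns to its right, so a new column on the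
  left merely shifts the index.\<close>

lemma avail_Cons_Suc: "avail (h # B) (x # \<phi>) (Suc c) = avail B \<phi> c"
proof -
  have "d \<in> {Suc c<..<length (h # B)} \<longleftrightarrow> d \<in> Suc ` {c<..<length B}" for d
    by (cases d) auto
  then have "{Suc c<..<length (h # B)} = Suc ` {c<..<length B}"
    by blast
  then show ?thesis
    unfolding avail_def by (simp add: sum.reindex)
qed

text \<open>Counts the same rooks by column and by weight; the hypothesis guarantees that no rook
  escapes the summation range of \<open>gain\<close>.\<close>

lemma gain_eq_sum:
  assumes "\<And>c w p. c < length \<phi> \<Longrightarrow> \<phi> ! c = Some (w, p) \<Longrightarrow> w \<le> s"
  shows "(\<Sum>d<length \<phi>. case \<phi> ! d of None \<Rightarrow> 0 | Some (w, p) \<Rightarrow> int w - 1) = gain s \<phi>"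
  using assms
proof (induction \<phi>)
  case (Cons x \<phi>)
  have "c < length \<phi> \<Longrightarrow> \<phi> ! c = Some (w, p) \<Longrightarrow> w \<le> s" for c w p
    using Cons.prems[of "Suc c"] by simp
  note IH = Cons.IH[OF this]
  show ?case
    using IH Cons.prems[of 0]
    by (cases x) (auto simp: sum.lessThan_Suc_shift simp del: sum.lessThan_Suc)
qed simp

text \<open>Every rook of the old placement lies to the right of the new column, so all of them
  contribute to its cells.\<close>

lemma avail_Cons_0:
  assumes "\<phi> \<in> placements s B"
  shows "avail (h # B) (x # \<phi>) 0 = int h + gain s \<phi>"
proof -
  have "{0<..<length (h # B)} = Suc ` {..<length B}"
    by (auto simp: image_iff lessThan_def gr0_conv_Suc)
  then have "avail (h # B) (x # \<phi>) 0 =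
      int h + (\<Sum>d<length \<phi>. case \<phi> ! d of None \<Rightarrow> 0 | Some (w, p) \<Rightarrow> int w - 1)"
    using assms unfolding avail_def by (simp add: sum.reindex placements_def)
  also have "\<dots> = int h + gain s \<phi>"
    using assms by (subst gain_eq_sum) (auto simp: placements_def)
  finally show ?thesis .
qed

section \<open>Column by column generation of placements\<close>

definition column_choices :: "nat \<Rightarrow> nat \<Rightarrow> (nat \<times> nat) option set" where
  "column_choices s a = insert None (Some ` ({..s} \<times> {1..a}))"

lemma placements_Nil [simp]: "placements s [] = {[]}"
  by (auto simp: placements_def)

lemma Cons_mem_placements:
  "x # \<phi> \<in> placements s (h # B) \<longleftrightarrow>
   \<phi> \<in> placements s B \<and> x \<in> column_choices s (nat (int h + gain s \<phi>))"
proof -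
  have "x # \<phi> \<in> placements s (h # B) \<longleftrightarrow> \<phi> \<in> placements s B \<and>
     (\<forall>w p. x = Some (w, p) \<longrightarrow> w \<le> s \<and> 1 \<le> p \<and> int p \<le> avail (h # B) (x # \<phi>) 0)"
    unfolding placements_def mem_Collect_eq length_Cons All_less_Suc2 nth_Cons_0 nth_Cons_Suc
      avail_Cons_Suc nat.inject by blast
  also have "\<dots> \<longleftrightarrow> \<phi> \<in> placements s B \<and> x \<in> column_choices s (nat (int h + gain s \<phi>))"
    \<comment> \<open>A negative cell count would admit no position, in agreement with the empty
      range that \<open>nat\<close> then produces.\<close>
    by (cases x) (auto simp: column_choices_def avail_Cons_0 image_iff)
  finally show ?thesis .
qed

text \<open>A dependent sum, because the number of cells of the leftmost column is known only once
  the columns to its right are filled.\<close>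

lemma placements_Cons:
  "placements s (h # B) =
   (\<lambda>(\<phi>, x). x # \<phi>) ` (SIGMA \<phi>:placements s B. column_choices s (nat (int h + gain s \<phi>)))"
  (is "_ = ?R")
proof (rule Set.set_eqI)
  fix \<psi>
  show "\<psi> \<in> placements s (h # B) \<longleftrightarrow> \<psi> \<in> ?R"
  proof (cases \<psi>)
    case Nil
    then show ?thesis by (auto simp: placements_def)
  next
    case (Cons x \<phi>)
    then show ?thesis by (auto simp: Cons_mem_placements image_iff)
  qed
qed

lemma finite_placements: "finite (placements s B)"
  by (induction B) (auto simp: placements_Cons column_choices_def)

text \<open>Positions are summed outside weights so that the result lines up with the double sum in
  \<open>cls_X_Y_power\<close>.\<close>

lemma sum_placements_Cons:
  "sum g (placements s (h # B)) =
   (\<Sum>\<phi>\<in>placements s B. g (None # \<phi>) +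
      (\<Sum>p=1..nat (int h + gain s \<phi>). \<Sum>w\<le>s. g (Some (w, p) # \<phi>)))"
proof -
  have "sum g (placements s (h # B)) =
      (\<Sum>(\<phi>, x)\<in>(SIGMA \<phi>:placements s B. column_choices s (nat (int h + gain s \<phi>))). g (x # \<phi>))"
    unfolding placements_Cons by (subst sum.reindex) (auto simp: inj_on_def case_prod_unfold)
  also have "\<dots> = (\<Sum>\<phi>\<in>placements s B. \<Sum>x\<in>column_choices s (nat (int h + gain s \<phi>)). g (x # \<phi>))"
    by (rule sum.Sigma[symmetric]) (auto simp: finite_placements column_choices_def)
  also have "\<dots> = (\<Sum>\<phi>\<in>placements s B. g (None # \<phi>) +
      (\<Sum>w\<le>s. \<Sum>p=1..nat (int h + gain s \<phi>). g (Some (w, p) # \<phi>)))"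
    unfolding column_choices_def
    by (intro sum.cong refl) (simp add: image_iff sum.reindex sum.cartesian_product case_prod_unfold)
  also have "\<dots> = (\<Sum>\<phi>\<in>placements s B. g (None # \<phi>) +
      (\<Sum>p=1..nat (int h + gain s \<phi>). \<Sum>w\<le>s. g (Some (w, p) # \<phi>)))"
    by (subst sum.swap) simp
  finally show ?thesis .
qed

lemma empty_boxes_Nil [simp]: "empty_boxes [] \<phi> = 0"
  by (simp add: empty_boxes_def)

lemma empty_boxes_Cons:
  assumes "\<phi> \<in> placements s B"
  shows "empty_boxes (h # B) (x # \<phi>) =
    (case x of None \<Rightarrow> nat (int h + gain s \<phi>) | Some (w, p) \<Rightarrow> p - 1) + empty_boxes B \<phi>"
  unfolding empty_boxes_def length_Cons sum.lessThan_Suc_shift nth_Cons_0 nth_Cons_Suc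
    avail_Cons_0[OF assms] avail_Cons_Suc ..

text \<open>Each column holds at most one rook; this keeps the exponent of X from
  truncating.\<close>

lemma rooks_le_length: "\<phi> \<in> placements s B \<Longrightarrow> rooks s \<phi> \<le> length B"
  by (induction B arbitrary: \<phi>) (auto simp: placements_Cons column_choices_def le_SucI)

section \<open>Normal ordering\<close>

lemma length_board [simp]: "length (board w) = count_list w LX"
  by (induction w rule: board.induct) auto

text \<open>The column of a new X has exactly as many cells as the current exponent of Y. A rook
  lowers that exponent by at most one and needs a cell, so it is placed only when the exponent is
  positive.\<close>

lemma exponent_nonneg:
  "\<phi> \<in> placements s (board w) \<Longrightarrow> 0 \<le> int (count_list w LY) + gain s \<phi>"
  by (induction w arbitrary: \<phi> rule: board.induct)
     (fastforce simp: placements_Cons column_choices_def)+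

text \<open>The scaled monomial contributed by one placement. The letter counts \<open>N\<close> and
  \<open>M\<close> are separate from the board because a Y in front of the word changes
  \<open>N\<close> alone.\<close>

definition placement_term ::
    "nat \<Rightarrow> (nat \<Rightarrow> complex) \<Rightarrow> complex \<Rightarrow> nat list \<Rightarrow> nat \<Rightarrow> nat \<Rightarrow> placement \<Rightarrow> free_poly" where
  "placement_term s \<alpha> q B N M \<phi> =
     free_const (rook_weight s \<alpha> \<phi> * q ^ empty_boxes B \<phi>) *
     (free_gen LY ^ nat (int N + gain s \<phi>) * free_gen LX ^ (M - rooks s \<phi>))"

lemma cls_X_placement_term:
  fixes \<alpha> :: "nat \<Rightarrow> complex" and q :: complex
  assumes "\<phi> \<in> placements s (board w)"
  defines "T \<equiv> placement_term s \<alpha> q (count_list w LY # board w) (count_list w LY) (Suc (count_list w LX))"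
  shows "weyl_class s \<alpha> q (free_gen LX *
       placement_term s \<alpha> q (board w) (count_list w LY) (count_list w LX) \<phi>) =
     weyl_class s \<alpha> q (T (None # \<phi>) +
       (\<Sum>p=1..nat (int (count_list w LY) + gain s \<phi>). \<Sum>v\<le>s. T (Some (v, p) # \<phi>)))"
proof -
  let ?X = "free_gen LX" and ?Y = "free_gen LY"
  \<comment> \<open>With these abbreviations the term of \<open>\<phi>\<close> is
    \<open>c Y^e X^b\<close>, and \<open>e\<close> is also the number of available cells of the new
    column.\<close>
  define e where "e = nat (int (count_list w LY) + gain s \<phi>)"
  define b where "b = count_list w LX - rooks s \<phi>"
  define c where "c = rook_weight s \<alpha> \<phi> * q ^ empty_boxes (board w) \<phi>"
  have e: "int (count_list w LY) + gain s \<phi> = int e"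
    using exponent_nonneg[OF assms(1)] by (simp add: e_def)
  have b: "Suc (count_list w LX) - rooks s \<phi> = Suc b"
    using rooks_le_length[OF assms(1)] by (simp add: b_def)
  have T_None: "T (None # \<phi>) = free_const c * (free_const (q ^ e) * (?Y ^ e * ?X) * ?X ^ b)"
  proof -
    have "rook_weight s \<alpha> (None # \<phi>) *
        q ^ empty_boxes (count_list w LY # board w) (None # \<phi>) = c * q ^ e"
      by (simp add: empty_boxes_Cons[OF assms(1)] e c_def power_add)
    then show ?thesis
      by (simp add: T_def placement_term_def e b free_const_mult mult.assoc)
  qed
  \<comment> \<open>Positions start at 1, so position \<open>Suc i\<close> leaves \<open>i\<close>
    empty boxes below the rook. The bound \<open>i < e\<close> makes \<open>e - 1\<close>
    exact.\<close>
  have T_Some: "T (Some (v, Suc i) # \<phi>) =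
      free_const c * (free_const (q ^ i * \<alpha> v) * ?Y ^ (e - 1 + v) * ?X ^ b)"
    if "v \<le> s" "i < e" for v i
  proof -
    have "nat (int (count_list w LY) + gain s (Some (v, Suc i) # \<phi>)) = e - 1 + v"
      using e that by simp
    moreover have "Suc (count_list w LX) - rooks s (Some (v, Suc i) # \<phi>) = b"
      using that by (simp add: b_def)
    moreover have "rook_weight s \<alpha> (Some (v, Suc i) # \<phi>) *
        q ^ empty_boxes (count_list w LY # board w) (Some (v, Suc i) # \<phi>) = c * (q ^ i * \<alpha> v)"
      using that by (simp add: empty_boxes_Cons[OF assms(1)] c_def power_add)
    ultimately show ?thesis
      by (simp only: T_def placement_term_def free_const_mult mult.assoc)
  qed
  have "?X * placement_term s \<alpha> q (board w) (count_list w LY) (count_list w LX) \<phi> =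
      free_const c * ((?X * ?Y ^ e) * ?X ^ b)"
    by (simp add: placement_term_def e_def b_def c_def free_const_gen_left_commute mult.assoc)
  also have "weyl_class s \<alpha> q \<dots> = weyl_class s \<alpha> q (free_const c *
      ((free_const (q ^ e) * (?Y ^ e * ?X) +
        (\<Sum>i<e. \<Sum>v\<le>s. free_const (q ^ i * \<alpha> v) * ?Y ^ (e - 1 + v))) * ?X ^ b))"
    by (intro cls_mult_cong refl cls_X_Y_power)
  also have "free_const c *
      ((free_const (q ^ e) * (?Y ^ e * ?X) +
        (\<Sum>i<e. \<Sum>v\<le>s. free_const (q ^ i * \<alpha> v) * ?Y ^ (e - 1 + v))) * ?X ^ b) =
      T (None # \<phi>) + (\<Sum>i<e. \<Sum>v\<le>s. T (Some (v, Suc i) # \<phi>))"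
    by (simp add: T_None T_Some distrib_left distrib_right sum_distrib_left sum_distrib_right)
  also have "(\<Sum>i<e. \<Sum>v\<le>s. T (Some (v, Suc i) # \<phi>)) = (\<Sum>p=1..e. \<Sum>v\<le>s. T (Some (v, p) # \<phi>))"
    by (rule sum.reindex_bij_witness[of _ "\<lambda>p. p - 1" Suc]) auto
  finally show ?thesis by (simp add: e_def)
qed

text \<open>The remaining word is normally ordered by the induction hypothesis before the new letter
  is multiplied in from the left: X extends every placement by a column, Y keeps the board.\<close>

lemma cls_word_placements:
  "weyl_class s \<alpha> q (prod_list (map free_gen w)) =
   weyl_class s \<alpha> q (\<Sum>\<phi>\<in>placements s (board w).
     placement_term s \<alpha> q (board w) (count_list w LY) (count_list w LX) \<phi>)"
proof (induction w rule: board.induct)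
  case 1
  then show ?case by (simp add: placement_term_def)
next
  case (2 w)
  have "weyl_class s \<alpha> q (free_gen LX * prod_list (map free_gen w)) =
      weyl_class s \<alpha> q (\<Sum>\<phi>\<in>placements s (board w). free_gen LX *
        placement_term s \<alpha> q (board w) (count_list w LY) (count_list w LX) \<phi>)"
    unfolding sum_distrib_left[symmetric] by (rule cls_mult_cong[OF refl 2])
  also have "\<dots> = weyl_class s \<alpha> q (\<Sum>\<phi>\<in>placements s (board (LX # w)).
      placement_term s \<alpha> q (board (LX # w)) (count_list w LY) (Suc (count_list w LX)) \<phi>)"
    unfolding board.simps sum_placements_Cons by (rule cls_sum_cong) (rule cls_X_placement_term)
  finally show ?case by simp
next
  case (3 w)
  have "free_gen LY * placement_term s \<alpha> q (board w) (count_list w LY) (count_list w LX) \<phi> =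
      placement_term s \<alpha> q (board w) (Suc (count_list w LY)) (count_list w LX) \<phi>"
    if "\<phi> \<in> placements s (board w)" for \<phi>
  proof -
    \<comment> \<open>Nonnegativity of the old exponent is what allows \<open>Suc\<close> to leave
      \<open>nat\<close>.\<close>
    have "nat (int (Suc (count_list w LY)) + gain s \<phi>) = Suc (nat (int (count_list w LY) + gain s \<phi>))"
      using exponent_nonneg[OF that] by simp
    then show ?thesis
      by (simp add: placement_term_def free_const_gen_left_commute mult.assoc)
  qed
  then have eq: "free_gen LY * (\<Sum>\<phi>\<in>placements s (board w).
        placement_term s \<alpha> q (board w) (count_list w LY) (count_list w LX) \<phi>) =
      (\<Sum>\<phi>\<in>placements s (board w).
        placement_term s \<alpha> q (board w) (Suc (count_list w LY)) (count_list w LX) \<phi>)"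
    by (simp add: sum_distrib_left)
  have "weyl_class s \<alpha> q (free_gen LY * prod_list (map free_gen w)) =
      weyl_class s \<alpha> q (free_gen LY * (\<Sum>\<phi>\<in>placements s (board w).
        placement_term s \<alpha> q (board w) (count_list w LY) (count_list w LX) \<phi>))"
    by (rule cls_mult_cong[OF refl 3])
  then show ?case
    unfolding eq by simp
qed

section \<open>Grouping placements by type\<close>

text \<open>Without a cell in the rightmost column no rook can start, and without rooks no row is
  ever created for the next column.\<close>

lemma placements_zero: "\<phi> \<in> placements s (replicate m 0) \<Longrightarrow> gain s \<phi> = 0 \<and> rooks s \<phi> = 0"
proof (induction m arbitrary: \<phi>)
  case (Suc m)
  then obtain x \<psi> where "\<phi> = x # \<psi>" "\<psi> \<in> placements s (replicate m 0)"
    "x \<in> column_choices s (nat (gain s \<psi>))"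
    by (auto simp: placements_Cons)
  with Suc.IH[of \<psi>] show ?case by (auto simp: column_choices_def)
qed simp

lemma board_replicate_LX: "board (replicate m LX) = replicate m 0"
  by (induction m) (auto simp: count_list_0_iff)

text \<open>The trailing X have no Y to their right and so carry no rooks; each X of
  \<open>u\<close> carries at most one.\<close>

lemma rooks_le_count:
  "\<phi> \<in> placements s (board (u @ replicate m LX)) \<Longrightarrow> rooks s \<phi> \<le> count_list u LX"
proof (induction u arbitrary: \<phi> rule: board.induct)
  case 1
  then show ?case using placements_zero by (simp add: board_replicate_LX)
qed (auto simp: placements_Cons column_choices_def le_SucI)

section \<open>Types of placements and the grouping of the sum\<close>

definition placement_type :: "nat \<Rightarrow> placement \<Rightarrow> nat list" where
  "placement_type s \<phi> = map (rook_count \<phi>) [0..<Suc s]"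

lemma sum_list_placement_type: "sum_list (placement_type s \<phi>) = rooks s \<phi>"
  unfolding placement_type_def rooks_def interv_sum_list_conv_sum_set_nat
  by (simp add: atLeast0LessThan lessThan_Suc_atMost del: upt_Suc)

text \<open>The nested comprehension is the fibre shape of a two-stage grouping, first by number of
  rooks and then by type.\<close>

lemma mixed_placements_eq:
  assumes "ks \<in> weak_compositions (s + 1) k"
  shows "mixed_placements s ks B =
    {\<phi> \<in> {\<phi> \<in> placements s B. rooks s \<phi> = k}. placement_type s \<phi> = ks}"
proof -
  have "(\<forall>w\<le>s. rook_count \<phi> w = ks ! w) \<longleftrightarrow> placement_type s \<phi> = ks" for \<phi>
    using assms by (auto simp: weak_compositions_def placement_type_def list_eq_iff_nth_eq less_Suc_eq_le simp del: upt_Suc)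
  moreover have "placement_type s \<phi> = ks \<Longrightarrow> rooks s \<phi> = k" for \<phi>
    using assms sum_list_placement_type[of s \<phi>] by (simp add: weak_compositions_def)
  moreover have "card {c. c < length B \<and> (\<exists>p. \<phi> ! c = Some (w, p))} = rook_count \<phi> w"
    if "length \<phi> = length B" for \<phi> w
    using that by (simp add: rook_count_def length_filter_conv_card)
  then have "\<phi> \<in> mixed_placements s ks B \<longleftrightarrow>
      \<phi> \<in> placements s B \<and> (\<forall>w\<le>s. rook_count \<phi> w = ks ! w)" for \<phi>
    by (simp add: mixed_placements_def placements_def cong: conj_cong)
  ultimately show ?thesis by blast
qed

lemma finite_weak_compositions: "finite (weak_compositions l k)"
proof (rule finite_subset)
  show "weak_compositions l k \<subseteq> {xs. set xs \<subseteq> {..k} \<and> length xs = l}"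
    using member_le_sum_list unfolding weak_compositions_def by blast
  show "finite {xs. set xs \<subseteq> {..k} \<and> length xs = l}"
    by (rule finite_lists_length_eq) simp
qed

text \<open>On placements of one type the product of the coefficients and both exponents are
  constant; only the power of \<open>q\<close> varies, and its sum is the factor in
  \<open>mixed_number\<close>.\<close>

lemma sum_placements_by_type:
  assumes "\<And>\<phi>. \<phi> \<in> placements s B \<Longrightarrow> rooks s \<phi> \<le> K"
  shows "(\<Sum>\<phi>\<in>placements s B. placement_term s \<alpha> q B N M \<phi>) =
    (\<Sum>k\<in>{0..K}. \<Sum>ks\<in>weak_compositions (s + 1) k. free_const (mixed_number s \<alpha> q ks B) *
       (free_gen LY ^ y_exponent s N ks * free_gen LX ^ (M - k)))"
proof -
  have type: "free_const (mixed_number s \<alpha> q ks B) *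
       (free_gen LY ^ y_exponent s N ks * free_gen LX ^ (M - k)) =
      (\<Sum>\<phi> | \<phi> \<in> {\<phi> \<in> placements s B. rooks s \<phi> = k} \<and> placement_type s \<phi> = ks.
         placement_term s \<alpha> q B N M \<phi>)"
    if ks: "ks \<in> weak_compositions (s + 1) k" for ks k
  proof -
    have nth: "ks ! j = rook_count \<phi> j" if "placement_type s \<phi> = ks" "j \<le> s" for \<phi> j
      using that by (auto simp: placement_type_def simp del: upt_Suc)
    show ?thesis
      unfolding mixed_number_def mixed_placements_eq[OF ks] free_const_sum sum_distrib_left
        sum_distrib_right
    proof (intro sum.cong refl)
      fix \<phi> assume "\<phi> \<in> {\<phi> \<in> {\<phi> \<in> placements s B. rooks s \<phi> = k}. placement_type s \<phi> = ks}"
      then have \<phi>: "placement_type s \<phi> = ks" "rooks s \<phi> = k" by auto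
      show "free_const ((\<Prod>j\<le>s. \<alpha> j ^ (ks ! j)) * q ^ empty_boxes B \<phi>) *
          (free_gen LY ^ y_exponent s N ks * free_gen LX ^ (M - k)) = placement_term s \<alpha> q B N M \<phi>"
        using \<phi> by (simp add: placement_term_def rook_weight_def gain_def y_exponent_def nth)
    qed
  qed
  \<comment> \<open>The bound \<open>K\<close> puts every placement into one of the classes
    \<open>k = 0, ..., K\<close>.\<close>
  have "(\<Sum>\<phi>\<in>placements s B. placement_term s \<alpha> q B N M \<phi>) =
      (\<Sum>k\<in>{0..K}. \<Sum>\<phi> | \<phi> \<in> placements s B \<and> rooks s \<phi> = k. placement_term s \<alpha> q B N M \<phi>)"
    using assms by (intro sum.group[symmetric]) (auto simp: finite_placements)
  also have "\<dots> = (\<Sum>k\<in>{0..K}. \<Sum>ks\<in>weak_compositions (s + 1) k.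
      \<Sum>\<phi> | \<phi> \<in> {\<phi> \<in> placements s B. rooks s \<phi> = k} \<and> placement_type s \<phi> = ks.
         placement_term s \<alpha> q B N M \<phi>)"
  proof (intro sum.cong refl sum.group[symmetric])
    fix k
    show "placement_type s ` {\<phi> \<in> placements s B. rooks s \<phi> = k} \<subseteq> weak_compositions (s + 1) k"
      using sum_list_placement_type by (auto simp: weak_compositions_def) (simp add: placement_type_def)
  qed (auto simp: finite_placements finite_weak_compositions)
  finally show ?thesis
    by (simp add: type)
qed

section \<open>Letter counts and last block of the block word\<close>

lemma count_list_replicate: "count_list (replicate k x) y = (if x = y then k else 0)"
  by (induction k) auto

lemma block_word_Suc:
  "block_word (Suc r) n m = replicate (n (Suc r)) LY @ replicate (m (Suc r)) LX @ block_word r n m"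
  by (simp add: block_word_def)

lemma count_list_block_word:
  "count_list (block_word r n m) LY = (\<Sum>j=1..r. n j)"
  "count_list (block_word r n m) LX = (\<Sum>j=1..r. m j)"
  by (induction r) (simp_all add: block_word_Suc count_list_replicate, simp_all add: block_word_def)

text \<open>Blocks are listed by decreasing index, so block 1 comes last; it exists since
  \<open>r\<close> is positive.\<close>

lemma block_word_split:
  assumes "r \<ge> 1"
  obtains u where "block_word r n m = u @ replicate (m 1) LX"
proof -
  have "[1..<Suc r] = 1 # [2..<Suc r]"
    using assms by (simp add: upt_conv_Cons numeral_2_eq_2 del: upt_Suc)
  then have "block_word r n m =
      (concat (map (\<lambda>j. replicate (n j) LY @ replicate (m j) LX) (rev [2..<Suc r])) @
       replicate (n 1) LY) @ replicate (m 1) LX"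
    unfolding block_word_def by (simp del: upt_Suc)
  then show thesis by (rule that)
qed

theorem theorem4p9:
  fixes q :: complex and s r :: nat and \<alpha> :: "nat \<Rightarrow> complex" and n m :: "nat \<Rightarrow> nat"
  assumes "r \<ge> 1"
  defines "A \<equiv> weyl_alg s \<alpha> q"
    and "X \<equiv> weyl_gen s \<alpha> q LX"
    and "Y \<equiv> weyl_gen s \<alpha> q LY"
    and "w \<equiv> block_word r n m"
    and "N \<equiv> \<Sum>j=1..r. n j"
    and "M \<equiv> \<Sum>j=1..r. m j"
  shows "weyl_word s \<alpha> q w =
    (\<Oplus>\<^bsub>A\<^esub>k\<in>{0..M - m 1}. \<Oplus>\<^bsub>A\<^esub>ks\<in>weak_compositions (s + 1) k.
       weyl_scale s \<alpha> q (mixed_number s \<alpha> q ks (board w))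
         (Y [^]\<^bsub>A\<^esub> y_exponent s N ks \<otimes>\<^bsub>A\<^esub> X [^]\<^bsub>A\<^esub> (M - k)))"
proof -
  obtain u where u: "w = u @ replicate (m 1) LX"
    using block_word_split[OF assms(1)] unfolding w_def by metis
  have M: "count_list w LX = M" and N: "count_list w LY = N"
    by (simp_all add: w_def M_def N_def count_list_block_word)
  \<comment> \<open>Removing the trailing block leaves the X that can carry rooks, which gives the
    upper summation limit.\<close>
  have "count_list u LX = M - m 1"
    using M by (simp add: u count_list_replicate)
  then have rooks: "rooks s \<phi> \<le> M - m 1" if "\<phi> \<in> placements s (board w)" for \<phi>
    using rooks_le_count that unfolding u by metis
  have "weyl_word s \<alpha> q w = weyl_class s \<alpha> q
      (\<Sum>k\<in>{0..M - m 1}. \<Sum>ks\<in>weak_compositions (s + 1) k.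
         free_const (mixed_number s \<alpha> q ks (board w)) *
         (free_gen LY ^ y_exponent s N ks * free_gen LX ^ (M - k)))"
    unfolding cls_word cls_word_placements M N by (subst sum_placements_by_type[OF rooks]) auto
  then show ?thesis
    by (simp add: cls_sum finite_weak_compositions cls_mult cls_power A_def X_def Y_def
        weyl_gen_def weyl_scale_def)
qed

end
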